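(* Let $A\in\mathbb{S}^n$, let $k\le n$, let $\widehat V$ be an $n\times k$ matrix with orthonormal columns, and let $\widehat\Lambda$ be a $k\times k$ positive semidefinite matrix. Let $\widehat V_\perp$ be an $n\times(n-k)$ matrix with orthonormal columns spanning the nullspace of $\widehat V^T$. Put $R := A\widehat V-\widehat V\widehat\Lambda$ and $D_+ := \Pi_+(\widehat V_\perp^T A\widehat V_\perp)$. Then $$\|\widehat V\widehat\Lambda\widehat V^T-\Pi_+(A)\|_F^2\le \|R\|_F^2+\|\widehat V_\perp^TA\widehat V\|_F^2+\|D_+\|_F^2 .$$
   Context: $\mathbb{S}^n$ is the set of $n\times n$ Hermitian matrices (real symmetric in the real case), and $^T$ denotes the transpose (conjugate transpose in the complex case). $\|\cdot\|_F$ is the Frobenius norm. For a Hermitian matrix $A$ with eigenvalue decomposition $A=V_+\Lambda_+V_+^T+V_-\Lambda_-V_-^T$, where $[V_+\ V_-]$ is orthogonal (unitary) and the diagonal matrices $\Lambda_+$, $\Lambda_-$ contain the positive and the non-positive eigenvalues respectively, define $\Pi_+(A):=V_+\Lambda_+V_+^T$ (the projection onto the positive semidefinite cone). *)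

theory Defs
  imports
    "Jordan_Normal_Form.Schur_Decomposition"
    "Jordan_Normal_Form.VS_Connect"
    "Jordan_Normal_Form.Matrix_Kernel"
begin

text \<open>
  Everything is polymorphic in the scalars and meant for \<^typ>\<open>real\<close> and \<^typ>\<open>complex\<close>.
  \<^const>\<open>mat_adjoint\<close> is the conjugate transpose; it is the plain transpose over the reals, where
  \<^const>\<open>conjugate\<close> is the identity. On \<^typ>\<open>complex\<close> the order is that of \<^theory>\<open>HOL-Library.Complex_Order\<close>,
  so that \<open>0 < z\<close>, \<open>0 \<le> z\<close> and \<open>z \<le> 0\<close> each include that \<open>z\<close> is real.
  Matrices with no rows or no columns are allowed, so \<open>k = 0\<close>, \<open>k = n\<close> and eigenvalues
  of one sign only need no special treatment.
\<close>

definition hermitian_mat :: "nat \<Rightarrow> 'a :: conjugatable_field mat \<Rightarrow> bool" where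
  "hermitian_mat n A \<longleftrightarrow> A \<in> carrier_mat n n \<and> mat_adjoint A = A"

text \<open>Over the reals, the quadratic form alone would not force symmetry.\<close>

definition psd_mat :: "nat \<Rightarrow> 'a :: conjugatable_ordered_field mat \<Rightarrow> bool" where
  "psd_mat n A \<longleftrightarrow> hermitian_mat n A \<and> (\<forall>x \<in> carrier_vec n. 0 \<le> (A *\<^sub>v x) \<bullet>c x)"

definition orthonormal_cols :: "nat \<Rightarrow> nat \<Rightarrow> 'a :: conjugatable_field mat \<Rightarrow> bool" where
  "orthonormal_cols n k V \<longleftrightarrow> V \<in> carrier_mat n k \<and> mat_adjoint V * V = 1\<^sub>m k"

definition frob_norm :: "'a :: real_normed_vector mat \<Rightarrow> real" where
  "frob_norm A = sqrt (\<Sum>i<dim_row A. \<Sum>j<dim_col A. (norm (A $$ (i, j)))\<^sup>2)"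

text \<open>
  An eigenvalue decomposition separated by sign. The concatenation of the two blocks is an
  \<open>n \<times> n\<close> matrix with orthonormal columns, that is, orthogonal (unitary).
\<close>

definition signed_eigendecomp ::
  "'a :: conjugatable_ordered_field mat \<Rightarrow> 'a mat \<Rightarrow> 'a mat \<Rightarrow> 'a mat \<Rightarrow> 'a mat \<Rightarrow> bool" where
  "signed_eigendecomp A Vp Lp Vm Lm \<longleftrightarrow>
     (\<exists>n p q. A \<in> carrier_mat n n \<and> p + q = n \<and>
        Vp \<in> carrier_mat n p \<and> Vm \<in> carrier_mat n q \<and>
        orthonormal_cols n n (mat_of_cols n (cols Vp @ cols Vm)) \<and>
        Lp \<in> carrier_mat p p \<and> diagonal_mat Lp \<and> (\<forall>i<p. 0 < Lp $$ (i, i)) \<and>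
        Lm \<in> carrier_mat q q \<and> diagonal_mat Lm \<and> (\<forall>i<q. Lm $$ (i, i) \<le> 0) \<and>
        A = Vp * Lp * mat_adjoint Vp + Vm * Lm * mat_adjoint Vm)"

text \<open>
  A Hermitian matrix has such a decomposition; the decomposition is not unique, but
  \<open>Vp * Lp * mat_adjoint Vp\<close> does not depend on its choice.
\<close>

definition Pi_plus :: "'a :: conjugatable_ordered_field mat \<Rightarrow> 'a mat" where
  "Pi_plus A = (THE P. \<exists>Vp Lp Vm Lm.
      signed_eigendecomp A Vp Lp Vm Lm \<and> P = Vp * Lp * mat_adjoint Vp)"

end

theory Submission
  imports Defs
begin

text \<open>
  Write \<open>W\<close> for the orthonormal basis of the complement and split
  \<open>W\<^sup>T A W = D\<^sub>+ - M\<close> with \<open>D\<^sub>+\<close>, \<open>M\<close> positive semidefinite and \<open>D\<^sub>+ M = 0\<close>.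
  Then \<open>V \<Lambda> V\<^sup>T\<close> is the projection of \<open>B = V \<Lambda> V\<^sup>T - W M W\<^sup>T\<close> onto the positive semidefinite
  cone. This projection is nonexpansive in the Frobenius norm, so the left-hand side is at most
  the square of \<open>\<parallel>A - B\<parallel>\<^sub>F\<close>. By unitary invariance, the latter is the sum of the squared norms
  of the blocks of \<open>A - B\<close> in the basis \<open>[V W]\<close>: the columns \<open>(A - B) V = R\<close>, the block
  \<open>V\<^sup>T (A - B) W = (W\<^sup>T A V)\<^sup>T\<close> and the block \<open>W\<^sup>T (A - B) W = D\<^sub>+\<close>.
\<close>

section \<open>Adjoints, traces and Hermitian matrices\<close>

lemma mat_adjoint_carrier [simp]: "A \<in> carrier_mat n m \<Longrightarrow> mat_adjoint A \<in> carrier_mat m n"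
  by (auto simp: mat_adjoint_def)

lemma dim_mat_adjoint [simp]:
  "dim_row (mat_adjoint A) = dim_col A" "dim_col (mat_adjoint A) = dim_row A"
  by (auto simp: mat_adjoint_def)

lemma index_mat_adjoint [simp]:
  "i < dim_col A \<Longrightarrow> j < dim_row A \<Longrightarrow> mat_adjoint A $$ (i, j) = conjugate (A $$ (j, i))"
  by (simp add: mat_adjoint_def mat_of_rows_index)

lemma mat_adjoint_adjoint [simp]: "mat_adjoint (mat_adjoint A) = A"
  by (rule eq_matI) auto

lemma mat_adjoint_mult:
  assumes "A \<in> carrier_mat n m" "B \<in> carrier_mat m k"
  shows "mat_adjoint (A * B) = mat_adjoint B * mat_adjoint A"
  using assms
  by (intro eq_matI)
    (auto simp: scalar_prod_def sum_conjugate conjugate_dist_mul mult.commute intro!: sum.cong)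

lemma mat_adjoint_minus:
  assumes "A \<in> carrier_mat n m" "B \<in> carrier_mat n m"
  shows "mat_adjoint (A - B) = mat_adjoint A - mat_adjoint B"
  using assms
  by (intro eq_matI)
    (auto simp: conjugate_dist_add conjugate_neg simp flip: add_uminus_conv_diff)

lemma conjugate_one [simp]: "conjugate (1 :: 'a :: conjugatable_field) = 1"
  by (metis conjugate_dist_mul conjugate_id mult_1 mult.right_neutral)

lemma mat_adjoint_one [simp]: "mat_adjoint (1\<^sub>m n) = (1\<^sub>m n :: 'a :: conjugatable_field mat)"
  by (rule eq_matI) auto

lemma mat_adjoint_zero [simp]: "mat_adjoint (0\<^sub>m n m) = (0\<^sub>m m n :: 'a :: conjugatable_field mat)"
  by (rule eq_matI) auto

lemma mat_adjoint_four_block: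
  assumes "A \<in> carrier_mat n n" "B \<in> carrier_mat m m"
  shows "mat_adjoint (four_block_mat A (0\<^sub>m n m) (0\<^sub>m m n) B)
    = four_block_mat (mat_adjoint A) (0\<^sub>m n m) (0\<^sub>m m n) (mat_adjoint B)"
  using assms by (intro eq_matI) auto

lemma adjoint_scalar_prod:
  fixes A :: "'a :: conjugatable_field mat"
  assumes "A \<in> carrier_mat n m" "x \<in> carrier_vec m" "y \<in> carrier_vec n"
  shows "(A *\<^sub>v x) \<bullet>c y = x \<bullet>c (mat_adjoint A *\<^sub>v y)"
proof -
  have "(A *\<^sub>v x) \<bullet>c y = (\<Sum>i<n. \<Sum>j<m. A $$ (i, j) * x $ j * conjugate (y $ i))"
    using assms by (auto simp: scalar_prod_def sum_distrib_right lessThan_atLeast0)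
  also have "\<dots> = (\<Sum>j<m. \<Sum>i<n. A $$ (i, j) * x $ j * conjugate (y $ i))"
    by (rule sum.swap)
  also have "\<dots> = x \<bullet>c (mat_adjoint A *\<^sub>v y)"
    using assms
    by (auto simp: scalar_prod_def sum_distrib_left lessThan_atLeast0 sum_conjugate
        conjugate_dist_mul ac_simps intro!: sum.cong)
  finally show ?thesis .
qed

section \<open>The trace and its cyclicity\<close>

definition mat_trace :: "'a :: comm_ring_1 mat \<Rightarrow> 'a" where
  "mat_trace A = (\<Sum>i<dim_row A. A $$ (i, i))"

lemma mat_trace_mult:
  assumes "A \<in> carrier_mat n m" "B \<in> carrier_mat m n"
  shows "mat_trace (A * B) = (\<Sum>i<n. \<Sum>j<m. A $$ (i, j) * B $$ (j, i))"
  using assms by (auto simp: mat_trace_def scalar_prod_def lessThan_atLeast0 intro!: sum.cong)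

lemma mat_trace_mult_commute:
  assumes "A \<in> carrier_mat n m" "B \<in> carrier_mat m n"
  shows "mat_trace (A * B) = mat_trace (B * A)"
  unfolding mat_trace_mult[OF assms] mat_trace_mult[OF assms(2,1)]
  by (subst sum.swap) (simp add: mult.commute)

lemma mat_trace_add:
  assumes "A \<in> carrier_mat n n" "B \<in> carrier_mat n n"
  shows "mat_trace (A + B) = mat_trace A + mat_trace B"
  using assms by (simp add: mat_trace_def sum.distrib)

lemma mat_trace_minus:
  assumes "A \<in> carrier_mat n n" "B \<in> carrier_mat n n"
  shows "mat_trace (A - B) = mat_trace A - mat_trace B"
  using assms by (simp add: mat_trace_def sum_subtractf)

lemma mat_trace_zero [simp]: "mat_trace (0\<^sub>m n n) = 0"
  by (simp add: mat_trace_def)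

section \<open>Congruence transformations and eigenvalues of Hermitian matrices\<close>

lemma hermitian_matD:
  assumes "hermitian_mat n A"
  shows "A \<in> carrier_mat n n" "mat_adjoint A = A"
  using assms by (auto simp: hermitian_mat_def)

lemma hermitian_mat_congruence:
  assumes "hermitian_mat n A" "U \<in> carrier_mat n m"
  shows "hermitian_mat m (mat_adjoint U * A * U)"
proof -
  have A: "A \<in> carrier_mat n n" "mat_adjoint A = A" using hermitian_matD assms by auto
  have "mat_adjoint (mat_adjoint U * A * U) = mat_adjoint U * mat_adjoint (mat_adjoint U * A)"
    using A assms(2) by (intro mat_adjoint_mult) auto
  also have "mat_adjoint (mat_adjoint U * A) = A * U"
    using A assms(2) mat_adjoint_mult[of "mat_adjoint U" m n A n] by simp
  also have "mat_adjoint U * (A * U) = mat_adjoint U * A * U"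
    using A assms(2) assoc_mult_mat[of "mat_adjoint U" m n A n U m] by simp
  finally show ?thesis
    using A assms(2) unfolding hermitian_mat_def by (meson mat_adjoint_carrier mult_carrier_mat)
qed

text \<open>The quadratic form of the new matrix at \<open>x\<close> is that of \<open>A\<close> at
  \<open>mat_adjoint U *\<^sub>v x\<close>.\<close>

lemma psd_mat_congruence:
  fixes A :: "'a :: conjugatable_ordered_field mat"
  assumes "psd_mat n A" "U \<in> carrier_mat m n"
  shows "psd_mat m (U * A * mat_adjoint U)"
proof -
  have A: "hermitian_mat n A" "A \<in> carrier_mat n n" using assms by (auto simp: psd_mat_def hermitian_mat_def)
  note U = assms(2)
  have "0 \<le> (U * A * mat_adjoint U *\<^sub>v x) \<bullet>c x" if x: "x \<in> carrier_vec m" for x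
  proof -
    have "(U * A * mat_adjoint U *\<^sub>v x) = U *\<^sub>v (A *\<^sub>v (mat_adjoint U *\<^sub>v x))"
      using A U x
        assoc_mult_mat_vec[of "U * A" m n "mat_adjoint U" m x]
        assoc_mult_mat_vec[of U m n A n "mat_adjoint U *\<^sub>v x"]
      by (simp add: mult_mat_vec_carrier[of _ n m])
    then have "(U * A * mat_adjoint U *\<^sub>v x) \<bullet>c x = (A *\<^sub>v (mat_adjoint U *\<^sub>v x)) \<bullet>c (mat_adjoint U *\<^sub>v x)"
      using A U x
      by (simp add: adjoint_scalar_prod[of U m n] mult_mat_vec_carrier[of _ n n] mult_mat_vec_carrier[of _ n m])
    then show ?thesis using assms(1) U x by (simp add: psd_mat_def mult_mat_vec_carrier[of _ n m])
  qed
  then show ?thesis using hermitian_mat_congruence[OF A(1), of "mat_adjoint U" m] U by (auto simp: psd_mat_def)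
qed

text \<open>For an eigenvector \<open>v\<close>, moving \<open>A\<close> across the form evaluates
  \<open>(A *\<^sub>v v) \<bullet>c v\<close> both as \<open>e\<close> and as \<open>cnj e\<close>
  times the nonzero number \<open>v \<bullet>c v\<close>.\<close>

lemma complex_hermitian_eigenvalue_real:
  fixes A :: "complex mat"
  assumes "hermitian_mat n A" "eigenvalue A e"
  shows "e \<in> \<real>"
proof -
  have A: "A \<in> carrier_mat n n" "mat_adjoint A = A" using hermitian_matD assms by auto
  obtain v where v: "v \<in> carrier_vec n" "v \<noteq> 0\<^sub>v n" "A *\<^sub>v v = e \<cdot>\<^sub>v v"
    using assms(2) A by (auto simp: eigenvalue_def eigenvector_def)
  have "e * (v \<bullet>c v) = (A *\<^sub>v v) \<bullet>c v" using v by simp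
  also have "\<dots> = v \<bullet>c (A *\<^sub>v v)" using adjoint_scalar_prod[OF A(1) v(1) v(1)] A(2) by simp
  also have "\<dots> = cnj e * (v \<bullet>c v)" using v by (simp add: conjugate_smult_vec)
  finally have "e = cnj e" using v by (simp add: conjugate_square_eq_0_vec)
  then show ?thesis by (metis Reals_cnj_iff)
qed

lemma complex_hermitian_eigenvalue_exists:
  fixes A :: "complex mat"
  assumes "hermitian_mat n A" "n > 0"
  shows "\<exists>e. eigenvalue A e"
proof -
  have A: "A \<in> carrier_mat n n" using hermitian_matD assms by auto
  have "degree (char_poly A) = n" using degree_monic_char_poly[OF A] by simp
  then have "\<not> constant (poly (char_poly A))" using assms(2) by (simp add: constant_degree)
  then obtain e where "poly (char_poly A) e = 0"
    using fundamental_theorem_of_algebra by blast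
  then show ?thesis using eigenvalue_root_char_poly[OF A] by blast
qed

section \<open>The scalars\<close>

text \<open>
  The map \<open>to_complex\<close> makes a uniform treatment of the reals and the complex numbers possible:
  the characteristic polynomial of a real symmetric matrix has a real root because its complex
  image is Hermitian.
\<close>

class rc_field = conjugatable_ordered_field + real_normed_field +
  fixes to_complex :: "'a \<Rightarrow> complex"
  assumes to_complex_add: "to_complex (x + y) = to_complex x + to_complex y"
    and to_complex_mult: "to_complex (x * y) = to_complex x * to_complex y"
    and to_complex_one: "to_complex 1 = 1"
    and to_complex_scaleR: "to_complex (r *\<^sub>R x) = r *\<^sub>R to_complex x"
    and to_complex_conjugate: "to_complex (conjugate x) = cnj (to_complex x)"
    and norm_to_complex: "norm (to_complex x) = norm x"
    and to_complex_nonneg: "0 \<le> to_complex x \<longleftrightarrow> 0 \<le> x"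

instantiation real :: rc_field
begin
definition "to_complex (x :: real) = complex_of_real x"
instance by standard (simp_all add: to_complex_real_def complex_eq_iff less_eq_complex_def)
end

instantiation complex :: rc_field
begin
definition "to_complex (x :: complex) = x"
instance by standard (simp_all add: to_complex_complex_def)
end

text \<open>A field homomorphism is injective, so scalar identities can be checked on complex
  images, and characteristic polynomials can be transported.\<close>

global_interpretation to_complex: field_hom "to_complex :: 'a :: rc_field \<Rightarrow> complex"
proof
  show "to_complex (0 :: 'a) = 0" using to_complex_add[of "0 :: 'a" 0] by simp
qed (auto simp: to_complex_add to_complex_mult to_complex_one)

lemma to_complex_of_real [simp]: "to_complex (of_real r :: 'a :: rc_field) = of_real r"
  by (simp add: of_real_def to_complex_scaleR to_complex_one)

lemma of_real_nonneg_iff [simp]: "0 \<le> (of_real r :: 'a :: rc_field) \<longleftrightarrow> 0 \<le> r"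
  unfolding to_complex_nonneg[of "of_real r :: 'a", symmetric] to_complex_of_real
  by (simp add: less_eq_complex_def)

text \<open>The complex identity for the squared modulus, pulled back along the injective
  \<open>to_complex\<close>.\<close>

lemma mult_conjugate_self:
  fixes x :: "'a :: rc_field"
  shows "x * conjugate x = of_real ((norm x)\<^sup>2)"
proof -
  have "to_complex (x * conjugate x) = to_complex (of_real ((norm x)\<^sup>2) :: 'a)"
    unfolding to_complex_mult to_complex_conjugate to_complex_of_real complex_norm_square[symmetric]
      norm_to_complex ..
  then show ?thesis by (simp only: to_complex.eq_iff)
qed

lemma hermitian_eigenvalue_exists:
  fixes A :: "'a :: rc_field mat"
  assumes "hermitian_mat n A" "n > 0"
  obtains r where "eigenvalue A (of_real r)"
proof -
  have A: "A \<in> carrier_mat n n" "mat_adjoint A = A" using hermitian_matD assms by auto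
  let ?C = "map_mat to_complex A"
  have C: "?C \<in> carrier_mat n n" using A by simp
  have "hermitian_mat n ?C"
    unfolding hermitian_mat_def
  proof (intro conjI C eq_matI)
    fix i j assume "i < dim_row ?C" "j < dim_col ?C"
    then show "mat_adjoint ?C $$ (i, j) = ?C $$ (i, j)"
      using A(1) arg_cong[OF A(2), of "\<lambda>M. M $$ (i, j)"]
      by (simp flip: to_complex_conjugate)
  qed (use A in auto)
  then obtain e where e: "eigenvalue ?C e" "e \<in> \<real>"
    using complex_hermitian_eigenvalue_exists complex_hermitian_eigenvalue_real assms(2) by blast
  then obtain r where r: "e = of_real r" by (auto elim: Reals_cases)
  \<comment> \<open>The characteristic polynomial of \<open>?C\<close> is the coefficientwise image
    of that of \<open>A\<close>. The root is real, hence itself an image, so injectivity brings it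
    back to \<open>A\<close>.\<close>
  then have "poly (map_poly to_complex (char_poly A)) (to_complex (of_real r :: 'a)) = 0"
    using e(1) eigenvalue_root_char_poly[OF C] to_complex.char_poly_hom[OF A(1)]
    by (metis to_complex_of_real)
  then have "to_complex (poly (char_poly A) (of_real r)) = 0"
    by (simp only: to_complex.poly_map_poly)
  then have "poly (char_poly A) (of_real r) = 0" by simp
  then show ?thesis using that eigenvalue_root_char_poly[OF A(1)] by blast
qed

section \<open>The spectral theorem\<close>

definition unitary_mat :: "nat \<Rightarrow> 'a :: conjugatable_field mat \<Rightarrow> bool" where
  "unitary_mat n U \<longleftrightarrow> U \<in> carrier_mat n n \<and> mat_adjoint U * U = 1\<^sub>m n \<and> U * mat_adjoint U = 1\<^sub>m n"

text \<open>A one-sided inverse of a square matrix is two-sided.\<close>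

lemma unitary_matI:
  assumes "U \<in> carrier_mat n n" "mat_adjoint U * U = 1\<^sub>m n"
  shows "unitary_mat n U"
  using assms mat_mult_left_right_inverse[of "mat_adjoint U" n U] by (simp add: unitary_mat_def)

lemma unitary_mat_mult:
  assumes "unitary_mat n U" "unitary_mat n V"
  shows "unitary_mat n (U * V)"
proof (rule unitary_matI)
  have UV: "U \<in> carrier_mat n n" "V \<in> carrier_mat n n" using assms by (auto simp: unitary_mat_def)
  then show "U * V \<in> carrier_mat n n" by simp
  have "mat_adjoint (U * V) * (U * V) = mat_adjoint V * ((mat_adjoint U * U) * V)"
    using UV by (simp add: mat_adjoint_mult[OF UV] assoc_mult_mat[of _ n n _ n _ n])
  also have "\<dots> = 1\<^sub>m n" using assms by (auto simp: unitary_mat_def)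
  finally show "mat_adjoint (U * V) * (U * V) = 1\<^sub>m n" .
qed

lemma conjugate_of_real [simp]: "conjugate (of_real r :: 'a :: rc_field) = of_real r"
  by (metis complex_cnj_complex_of_real to_complex.eq_iff to_complex_conjugate to_complex_of_real)

lemma scalar_conjugate_self:
  fixes v :: "'a :: rc_field vec"
  shows "v \<bullet>c v = of_real (\<Sum>i<dim_vec v. (norm (v $ i))\<^sup>2)"
  by (auto simp: scalar_prod_def mult_conjugate_self lessThan_atLeast0 simp del: of_real_power intro!: sum.cong)

text \<open>Complete \<open>v\<close> to a basis, orthogonalise and normalise. A first column merely
  proportional to \<open>v\<close> suffices, since multiples of eigenvectors satisfy the same
  eigenvalue equation.\<close>

lemma unitary_mat_extend:
  fixes v :: "'a :: rc_field vec"
  assumes "v \<in> carrier_vec n" "v \<noteq> 0\<^sub>v n"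
  obtains U c where "unitary_mat n U" "col U 0 = c \<cdot>\<^sub>v v"
proof -
  interpret cof_vec_space n "TYPE('a)" .
  define ws where "ws = gram_schmidt n (basis_completion v)"
  note bc = basis_completion[OF assms]
  have len: "length ws = n" and ws: "set ws \<subseteq> carrier_vec n" and orth: "corthogonal ws"
    using gram_schmidt_result[OF bc(2,4,5) refl] bc(6) by (auto simp: ws_def)
  have n: "0 < n" using assms by (cases n) auto
  obtain vs where "basis_completion v = v # vs" using bc(6,7) n by (cases "basis_completion v") auto
  \<comment> \<open>Gram-Schmidt leaves the first vector of the basis unchanged.\<close>
  then have hd: "ws ! 0 = v"
    using gram_schmidt_hd[OF assms(1), of vs] len n by (cases ws) (auto simp: ws_def)
  define s where "s w = sqrt (\<Sum>i<dim_vec w. (norm (w $ i))\<^sup>2)" for w :: "'a vec"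
  have s: "w \<bullet>c w = (of_real (s w))\<^sup>2" for w
    unfolding scalar_conjugate_self of_real_power[symmetric] s_def
    by (subst real_sqrt_pow2) (auto intro: sum_nonneg)
  \<comment> \<open>The vectors \<open>ws\<close> are orthogonal but not yet of unit length, hence
    the division by \<open>s\<close>.\<close>
  define U where "U = mat n n (\<lambda>(i, j). ws ! j $ i / of_real (s (ws ! j)))"
  have wsi: "ws ! i \<in> carrier_vec n" if "i < n" for i using ws len that by auto
  have "(mat_adjoint U * U) $$ (i, j) = (1\<^sub>m n :: 'a mat) $$ (i, j)" if ij: "i < n" "j < n" for i j
  proof -
    have "(mat_adjoint U * U) $$ (i, j)
        = (\<Sum>l<n. conjugate (ws ! i $ l / of_real (s (ws ! i))) * (ws ! j $ l / of_real (s (ws ! j))))"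
      using ij by (auto simp: U_def scalar_prod_def lessThan_atLeast0 intro!: sum.cong)
    also have "\<dots> = (\<Sum>l<n. ws ! j $ l * conjugate (ws ! i $ l)) / (of_real (s (ws ! i)) * of_real (s (ws ! j)))"
    proof -
      have "conjugate (x / of_real r) = conjugate x / of_real r" for x :: 'a and r
        by (simp add: divide_inverse conjugate_dist_mul flip: of_real_inverse)
      then show ?thesis by (simp add: sum_divide_distrib mult.commute)
    qed
    also have "(\<Sum>l<n. ws ! j $ l * conjugate (ws ! i $ l)) = ws ! j \<bullet>c ws ! i"
      using wsi[OF ij(1)] wsi[OF ij(2)] by (auto simp: scalar_prod_def lessThan_atLeast0 intro!: sum.cong)
    finally have eq: "(mat_adjoint U * U) $$ (i, j)
        = (ws ! j \<bullet>c ws ! i) / (of_real (s (ws ! i)) * of_real (s (ws ! j)))" .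
    have orth': "(ws ! j \<bullet>c ws ! i = 0) = (j \<noteq> i)" using corthogonalD[OF orth] ij len by auto
    show ?thesis
    proof (cases "i = j")
      case True
      \<comment> \<open>Orthogonality in the sense of \<open>corthogonal\<close> includes that no
        vector is orthogonal to itself, so the length is nonzero.\<close>
      then have "of_real (s (ws ! i)) \<noteq> (0 :: 'a)" using orth' s[of "ws ! i"] by auto
      then show ?thesis unfolding eq using True ij s[of "ws ! i"] by (simp add: power2_eq_square)
    qed (use eq orth' ij in auto)
  qed
  then have "mat_adjoint U * U = 1\<^sub>m n" by (intro eq_matI) (auto simp: U_def)
  then have "unitary_mat n U" by (intro unitary_matI) (auto simp: U_def)
  moreover have "col U 0 = (1 / of_real (s v)) \<cdot>\<^sub>v v"
    using assms(1) n hd by (intro eq_vecI) (auto simp: U_def)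
  ultimately show thesis by (rule that)
qed

text \<open>Deflation by induction on the size: in a unitary basis that starts with an eigenvector,
  \<open>A\<close> becomes block diagonal with a real 1 by 1 block and a smaller Hermitian block, to
  which the induction hypothesis applies.\<close>

lemma hermitian_mat_diagonalize:
  fixes A :: "'a :: rc_field mat"
  assumes "hermitian_mat n A"
  obtains U d where "unitary_mat n U" "A = U * mat_diag n (\<lambda>i. of_real (d i)) * mat_adjoint U"
  using assms
proof (induction n arbitrary: A thesis)
  case 0
  show ?case
  proof (rule "0.prems"(1))
    show "unitary_mat 0 (1\<^sub>m 0 :: 'a mat)" by (simp add: unitary_mat_def)
    show "A = 1\<^sub>m 0 * mat_diag 0 (\<lambda>i. of_real (0 :: real)) * mat_adjoint (1\<^sub>m 0)"
      using hermitian_matD(1)[OF "0.prems"(2)] by (intro eq_matI) auto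
  qed
next
  case (Suc m)
  let ?n = "Suc m"
  have A: "A \<in> carrier_mat ?n ?n" using hermitian_matD Suc.prems by auto
  obtain r where "eigenvalue A (of_real r)" using hermitian_eigenvalue_exists[OF Suc.prems(2)] by auto
  then obtain v where v: "v \<in> carrier_vec ?n" "v \<noteq> 0\<^sub>v ?n" "A *\<^sub>v v = of_real r \<cdot>\<^sub>v v"
    using A by (auto simp: eigenvalue_def eigenvector_def)
  obtain U c where U: "unitary_mat ?n U" and col: "col U 0 = c \<cdot>\<^sub>v v"
    using unitary_mat_extend[OF v(1,2)] by blast
  have Uc: "U \<in> carrier_mat ?n ?n" using U by (simp add: unitary_mat_def)
  define B where "B = mat_adjoint U * A * U"
  have B: "hermitian_mat ?n B" using hermitian_mat_congruence[OF Suc.prems(2) Uc] by (simp add: B_def)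
  note Bc = hermitian_matD[OF B]
  have herm: "conjugate (B $$ (j, i)) = B $$ (i, j)" if "i < ?n" "j < ?n" for i j
    using Bc(1) arg_cong[OF Bc(2), of "\<lambda>M. M $$ (i, j)"] that by simp
  \<comment> \<open>As the first column of \<open>U\<close> is an eigenvector, the first column of
    \<open>B\<close> is \<open>r\<close> times that of \<open>mat_adjoint U * U\<close>.\<close>
  have col0: "B $$ (i, 0) = (if i = 0 then of_real r else 0)" if "i < ?n" for i
  proof -
    have "B = mat_adjoint U * (A * U)"
      using A Uc by (simp add: B_def assoc_mult_mat[of _ ?n ?n _ ?n _ ?n] mult_carrier_mat[of _ ?n ?n _ ?n])
    then have "B $$ (i, 0) = row (mat_adjoint U) i \<bullet> col (A * U) 0"
      using that A Uc by simp
    also have "col (A * U) 0 = of_real r \<cdot>\<^sub>v col U 0"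
    proof -
      have "col (A * U) 0 = A *\<^sub>v (c \<cdot>\<^sub>v v)" using col_mult2[OF A Uc] col by simp
      also have "\<dots> = c \<cdot>\<^sub>v (A *\<^sub>v v)" by (rule mult_mat_vec[OF A v(1)])
      also have "\<dots> = of_real r \<cdot>\<^sub>v col U 0"
        unfolding v(3) col by (simp only: smult_smult_assoc mult.commute)
      finally show ?thesis .
    qed
    also have "row (mat_adjoint U) i \<bullet> \<dots> = of_real r * (mat_adjoint U * U) $$ (i, 0)"
      using that Uc by simp
    finally show ?thesis using U that by (auto simp: unitary_mat_def)
  qed
  define C where "C = mat m m (\<lambda>(i, j). B $$ (Suc i, Suc j))"
  have Cc: "C \<in> carrier_mat m m" by (simp add: C_def)
  have "hermitian_mat m C"
    unfolding hermitian_mat_def by (intro conjI eq_matI) (auto simp: C_def herm)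
  then obtain P d where P: "unitary_mat m P" and C: "C = P * mat_diag m (\<lambda>i. of_real (d i)) * mat_adjoint P"
    using Suc.IH by blast
  have Pc: "P \<in> carrier_mat m m" using P by (simp add: unitary_mat_def)
  \<comment> \<open>The new eigenvalue \<open>r\<close> goes in front and those of the smaller block
    move up by one index.\<close>
  define d' where "d' i = (case i of 0 \<Rightarrow> r | Suc i \<Rightarrow> d i)" for i
  let ?e = "mat 1 1 (\<lambda>_. of_real r :: 'a)" and ?Dm = "mat_diag m (\<lambda>i. of_real (d i) :: 'a)"
  let ?D = "mat_diag ?n (\<lambda>i. of_real (d' i) :: 'a)"
  \<comment> \<open>\<open>Q\<close> fixes the first coordinate and diagonalises the remaining block
    by \<open>P\<close>.\<close>
  define Q where "Q = four_block_mat (1\<^sub>m 1) (0\<^sub>m 1 m) (0\<^sub>m m 1) P"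
  have Qc: "Q \<in> carrier_mat ?n ?n"
    using four_block_carrier_mat[OF one_carrier_mat[of 1] Pc] by (simp add: Q_def)
  have Qadj: "mat_adjoint Q = four_block_mat (1\<^sub>m 1) (0\<^sub>m 1 m) (0\<^sub>m m 1) (mat_adjoint P)"
    unfolding Q_def using Pc by (subst mat_adjoint_four_block) auto
  have "mat_adjoint Q * Q = four_block_mat (1\<^sub>m 1) (0\<^sub>m 1 m) (0\<^sub>m m 1) (1\<^sub>m m)"
    unfolding Qadj unfolding Q_def using P Pc
    by (subst mult_four_block_mat[of _ 1 1 _ m _ m _ _ 1 _ m]) (auto simp: unitary_mat_def)
  then have "unitary_mat ?n Q" by (intro unitary_matI Qc) simp
  have D: "?D = four_block_mat ?e (0\<^sub>m 1 m) (0\<^sub>m m 1) ?Dm"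
    by (intro eq_matI) (auto simp: d'_def mat_diag_def split: nat.splits)
  have Dc: "?D \<in> carrier_mat ?n ?n" by simp
  have "Q * ?D = four_block_mat ?e (0\<^sub>m 1 m) (0\<^sub>m m 1) (P * ?Dm)"
    unfolding D unfolding Q_def using Pc
    by (subst mult_four_block_mat[of _ 1 1 _ m _ m _ _ 1 _ m])
      (auto simp: left_mult_zero_mat[of ?Dm m m])
  then have "Q * ?D * mat_adjoint Q = four_block_mat ?e (0\<^sub>m 1 m) (0\<^sub>m m 1) C"
    unfolding Qadj C using Pc
    by (simp, subst mult_four_block_mat[of _ 1 1 _ m _ m _ _ 1 _ m])
      (auto simp: right_mult_zero_mat[of "P * ?Dm" m m] left_add_zero_mat[of "P * ?Dm * mat_adjoint P" m m])
  also have "\<dots> = B"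
  proof (rule eq_matI)
    fix i j assume ij: "i < dim_row B" "j < dim_col B"
    \<comment> \<open>The first row is the conjugate of the first column, so it also vanishes off
      the diagonal.\<close>
    then have "B $$ (0, j) = (if j = 0 then of_real r else 0)" if "i = 0"
      using herm[of 0 j] col0[of j] Bc by (auto split: if_splits)
    then show "four_block_mat ?e (0\<^sub>m 1 m) (0\<^sub>m m 1) C $$ (i, j) = B $$ (i, j)"
      using ij Bc Cc col0[of i] by (cases i; cases j) (auto simp: C_def)
  qed (use Bc Cc in auto)
  finally have BQ: "B = Q * ?D * mat_adjoint Q" ..
  have UB: "U * B * mat_adjoint U = A"
  proof -
    have "U * B * mat_adjoint U = (U * mat_adjoint U) * A * (U * mat_adjoint U)"
      unfolding B_def using A Uc by (simp add: assoc_mult_mat[of _ ?n ?n _ ?n _ ?n] mult_carrier_mat[of _ ?n ?n _ ?n])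
    then show ?thesis using U A by (simp add: unitary_mat_def)
  qed
  have "A = (U * Q) * ?D * mat_adjoint (U * Q)"
    unfolding UB[symmetric] BQ mat_adjoint_mult[OF Uc Qc]
    using Uc Qc Dc by (simp add: assoc_mult_mat[of _ ?n ?n _ ?n _ ?n] mult_carrier_mat[of _ ?n ?n _ ?n])
  with unitary_mat_mult[OF U \<open>unitary_mat ?n Q\<close>] show ?case by (rule Suc.prems(1))
qed

section \<open>Nonnegative scalars and diagonals of positive semidefinite matrices\<close>

lemma mult_nonneg:
  fixes x y :: "'a :: rc_field"
  assumes "0 \<le> x" "0 \<le> y"
  shows "0 \<le> x * y"
proof -
  \<comment> \<open>A complex number that is nonnegative in this partial order is a nonnegative
    real, and these are closed under products.\<close>
  have "0 \<le> to_complex x" "0 \<le> to_complex y" using assms by (simp_all only: to_complex_nonneg)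
  then have "0 \<le> to_complex (x * y)" by (simp add: to_complex_mult less_eq_complex_def)
  then show ?thesis by (simp only: to_complex_nonneg)
qed

lemma nonneg_conjugate:
  fixes x :: "'a :: rc_field"
  assumes "0 \<le> x"
  shows "conjugate x = x"
proof -
  have "0 \<le> to_complex x" using assms by (simp only: to_complex_nonneg)
  then have "cnj (to_complex x) = to_complex x" by (simp add: less_eq_complex_def complex_eq_iff)
  then show ?thesis by (metis to_complex.eq_iff to_complex_conjugate)
qed

lemma psd_mat_diagonal_nonneg:
  assumes "psd_mat n A" "i < n"
  shows "0 \<le> A $$ (i, i)"
proof -
  have A: "A \<in> carrier_mat n n" using assms by (auto simp: psd_mat_def hermitian_mat_def)
  have "0 \<le> (A *\<^sub>v unit_vec n i) \<bullet>c unit_vec n i" using assms by (simp add: psd_mat_def)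
  moreover have "conjugate (unit_vec n i) = (unit_vec n i :: 'a vec)"
    by (intro eq_vecI) (auto simp: unit_vec_def)
  ultimately show ?thesis using A assms(2) by simp
qed

text \<open>The quadratic form is the sum of the squared moduli of the coordinates, weighted by the
  diagonal; symmetry holds because nonnegative entries are real.\<close>

lemma psd_mat_diagonal:
  fixes D :: "'a :: rc_field mat"
  assumes "D \<in> carrier_mat n n" "diagonal_mat D" "\<And>i. i < n \<Longrightarrow> 0 \<le> D $$ (i, i)"
  shows "psd_mat n D"
  unfolding psd_mat_def hermitian_mat_def
proof (intro conjI ballI assms(1) eq_matI)
  fix i j assume "i < dim_row D" "j < dim_col D"
  then show "mat_adjoint D $$ (i, j) = D $$ (i, j)"
    using assms by (cases "i = j") (auto simp: diagonal_mat_def nonneg_conjugate)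
next
  fix x :: "'a vec" assume x: "x \<in> carrier_vec n"
  have "(D *\<^sub>v x) $ i = D $$ (i, i) * x $ i" if i: "i < n" for i
  proof -
    have "(D *\<^sub>v x) $ i = (\<Sum>j<n. D $$ (i, j) * x $ j)"
      using i assms x by (auto simp: scalar_prod_def lessThan_atLeast0)
    also have "\<dots> = (\<Sum>j<n. if j = i then D $$ (i, i) * x $ i else 0)"
      using i assms by (intro sum.cong) (auto simp: diagonal_mat_def)
    finally show ?thesis using i by simp
  qed
  then have "(D *\<^sub>v x) \<bullet>c x = (\<Sum>i<n. D $$ (i, i) * (x $ i * conjugate (x $ i)))"
    using assms(1) x by (auto simp: scalar_prod_def lessThan_atLeast0 mult.assoc intro!: sum.cong)
  also have "0 \<le> \<dots>"
    using assms by (intro sum_nonneg mult_nonneg[OF _ conjugate_square_positive]) auto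
  finally show "0 \<le> (D *\<^sub>v x) \<bullet>c x" .
qed (use assms in auto)

section \<open>Nonexpansiveness of the projection\<close>

text \<open>In an eigenbasis of \<open>A\<close> the trace becomes the sum of the eigenvalues of
  \<open>A\<close> times the diagonal entries of the transformed \<open>B\<close>, all of which are
  nonnegative.\<close>

lemma psd_mat_trace_mult_nonneg:
  fixes A B :: "'a :: rc_field mat"
  assumes A: "psd_mat n A" and B: "psd_mat n B"
  shows "0 \<le> mat_trace (A * B)"
proof -
  have c: "A \<in> carrier_mat n n" "B \<in> carrier_mat n n" using assms by (auto simp: psd_mat_def hermitian_mat_def)
  obtain U d where U: "unitary_mat n U" and AU: "A = U * mat_diag n (\<lambda>i. of_real (d i)) * mat_adjoint U"
    using hermitian_mat_diagonalize[of n A] A by (auto simp: psd_mat_def)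
  let ?D = "mat_diag n (\<lambda>i. of_real (d i)) :: 'a mat"
  have Uc: "U \<in> carrier_mat n n" using U by (simp add: unitary_mat_def)
  define C where "C = mat_adjoint U * B * U"
  have C: "psd_mat n C" using psd_mat_congruence[OF B, of "mat_adjoint U" n] Uc by (simp add: C_def)
  have Cc: "C \<in> carrier_mat n n" using c Uc unfolding C_def by (meson mat_adjoint_carrier mult_carrier_mat)
  have "mat_adjoint U * A * U = (mat_adjoint U * U) * ?D * (mat_adjoint U * U)"
    unfolding AU using Uc by (simp add: assoc_mult_mat[of _ n n _ n _ n] mult_carrier_mat[of _ n n _ n])
  also have "\<dots> = ?D"
    using U by (simp add: unitary_mat_def left_mult_one_mat[of ?D n n] right_mult_one_mat[of ?D n n])
  finally have D: "mat_adjoint U * A * U = ?D" .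
  \<comment> \<open>The eigenvalues are nonnegative because \<open>?D\<close> arises from
    \<open>A\<close> by congruence.\<close>
  have "psd_mat n ?D" using psd_mat_congruence[OF A, of "mat_adjoint U" n] Uc by (simp add: D)
  have "A * B = U * (?D * mat_adjoint U * B)"
    unfolding AU using Uc c by (simp add: assoc_mult_mat[of _ n n _ n _ n] mult_carrier_mat[of _ n n _ n])
  then have "mat_trace (A * B) = mat_trace (?D * mat_adjoint U * B * U)"
    using Uc c by (metis mat_trace_mult_commute mat_adjoint_carrier mult_carrier_mat mat_diag_dim)
  also have "?D * mat_adjoint U * B * U = ?D * C"
    unfolding C_def using Uc c by (simp add: assoc_mult_mat[of _ n n _ n _ n] mult_carrier_mat[of _ n n _ n])
  also have "mat_trace (?D * C) = (\<Sum>i<n. ?D $$ (i, i) * C $$ (i, i))"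
    unfolding mat_diag_mult_left[OF Cc] by (auto simp: mat_trace_def mat_diag_def)
  also have "0 \<le> \<dots>"
    using C \<open>psd_mat n ?D\<close> by (intro sum_nonneg mult_nonneg psd_mat_diagonal_nonneg) auto
  finally show ?thesis .
qed

text \<open>Stated in the scalar field, where the trace lives; real inequalities are recovered later
  because \<open>of_real\<close> reflects nonnegativity.\<close>

lemma frob_norm_square:
  fixes A :: "'a :: rc_field mat"
  shows "of_real ((frob_norm A)\<^sup>2) = mat_trace (A * mat_adjoint A)"
proof -
  have "(frob_norm A)\<^sup>2 = (\<Sum>i<dim_row A. \<Sum>j<dim_col A. (norm (A $$ (i, j)))\<^sup>2)"
    unfolding frob_norm_def by (intro real_sqrt_pow2 sum_nonneg) auto
  then show ?thesis
    by (subst mat_trace_mult[of _ "dim_row A" "dim_col A"])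
      (auto simp: mult_conjugate_self simp del: of_real_power intro!: sum.cong)
qed

text \<open>
  These are the optimality conditions of the projection onto the positive semidefinite cone,
  so \<open>P\<close> is unique; uniqueness comes out of nonexpansiveness with \<open>A = B\<close>.
\<close>

definition psd_splitting :: "nat \<Rightarrow> 'a :: conjugatable_ordered_field mat \<Rightarrow> 'a mat \<Rightarrow> 'a mat \<Rightarrow> bool" where
  "psd_splitting n A P N \<longleftrightarrow> psd_mat n P \<and> psd_mat n N \<and> P * N = 0\<^sub>m n n \<and> A = P - N"

lemma psd_splittingD:
  assumes "psd_splitting n A P N"
  shows "psd_mat n P" "psd_mat n N" "P * N = 0\<^sub>m n n" "A = P - N"
    "P \<in> carrier_mat n n" "N \<in> carrier_mat n n" "mat_adjoint P = P" "mat_adjoint N = N"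
  using assms by (auto simp: psd_splitting_def psd_mat_def hermitian_mat_def)

text \<open>With \<open>S = X - P\<close> and \<open>T = M - N\<close>, the matrix
  \<open>A - B\<close> equals \<open>T - S\<close>. Expanding its squared norm leaves those of
  \<open>S\<close> and \<open>T\<close> minus twice the trace of \<open>S * T\<close>, and
  complementarity makes this trace nonpositive.\<close>

lemma psd_splitting_nonexpansive:
  fixes A B :: "'a :: rc_field mat"
  assumes "psd_splitting n A P N" "psd_splitting n B X M"
  shows "(frob_norm (X - P))\<^sup>2 \<le> (frob_norm (A - B))\<^sup>2"
proof -
  note P = psd_splittingD[OF assms(1)] and X = psd_splittingD[OF assms(2)]
  define S where "S = X - P"
  define T where "T = M - N"
  have c: "S \<in> carrier_mat n n" "T \<in> carrier_mat n n" using P X by (auto simp: S_def T_def)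
  have adj: "mat_adjoint S = S" "mat_adjoint T = T"
    using P X by (auto simp: S_def T_def mat_adjoint_minus[of _ n n])
  have AB: "A - B = T - S" unfolding P(4) X(4) S_def T_def using P X by (intro eq_matI) auto
  have ST: "mat_trace (S * T) = - (mat_trace (X * N) + mat_trace (P * M))"
  proof -
    have "S * T = X * (M - N) - P * (M - N)"
      unfolding S_def T_def using P X by (intro minus_mult_distrib_mat) auto
    also have "X * (M - N) = X * M - X * N" using P X by (intro mult_minus_distrib_mat) auto
    also have "P * (M - N) = P * M - P * N" using P X by (intro mult_minus_distrib_mat) auto
    finally have "S * T = (X * M - X * N) - (P * M - P * N)" .
    moreover have "X * M \<in> carrier_mat n n" "X * N \<in> carrier_mat n n"
      "P * M \<in> carrier_mat n n" "P * N \<in> carrier_mat n n"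
      using P X by auto
    ultimately have "mat_trace (S * T)
        = (mat_trace (X * M) - mat_trace (X * N)) - (mat_trace (P * M) - mat_trace (P * N))"
      by (simp add: mat_trace_minus[of _ n] minus_carrier_mat[of _ n n])
    \<comment> \<open>The products \<open>X * M\<close> and \<open>P * N\<close> vanish by
      complementarity; only the mixed terms survive.\<close>
    then show ?thesis using P X by simp
  qed
  have "(T - S) * (T - S) = T * (T - S) - S * (T - S)"
    using c by (intro minus_mult_distrib_mat) auto
  also have "T * (T - S) = T * T - T * S" using c by (intro mult_minus_distrib_mat) auto
  also have "S * (T - S) = S * T - S * S" using c by (intro mult_minus_distrib_mat) auto
  finally have "(T - S) * (T - S) = (T * T - T * S) - (S * T - S * S)" .
  moreover have "T * T \<in> carrier_mat n n" "T * S \<in> carrier_mat n n"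
    "S * T \<in> carrier_mat n n" "S * S \<in> carrier_mat n n"
    using c by auto
  ultimately have "mat_trace ((T - S) * (T - S))
      = mat_trace (T * T) + mat_trace (S * S) - mat_trace (S * T) - mat_trace (S * T)"
    using c mat_trace_mult_commute[of T n n S]
    by (simp add: mat_trace_minus[of _ n] minus_carrier_mat[of _ n n])
  \<comment> \<open>Self-adjointness turns the traces of squares into squared Frobenius
    norms.\<close>
  moreover have "mat_adjoint (T - S) = T - S" using c adj by (simp add: mat_adjoint_minus[of _ n n])
  ultimately have "of_real ((frob_norm (A - B))\<^sup>2) - of_real ((frob_norm S)\<^sup>2)
      = of_real ((frob_norm T)\<^sup>2) + (mat_trace (X * N) + mat_trace (P * M))
        + (mat_trace (X * N) + mat_trace (P * M))"
    unfolding AB frob_norm_square adj by (simp add: ST)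
  also have "(0 :: 'a) \<le> \<dots>"
    using P X by (intro add_nonneg_nonneg psd_mat_trace_mult_nonneg[of n]) (auto simp del: of_real_power)
  finally show ?thesis unfolding of_real_diff[symmetric] of_real_nonneg_iff S_def by simp
qed

lemma frob_norm_eq_0:
  assumes "frob_norm (A - B) = 0" "A \<in> carrier_mat n m" "B \<in> carrier_mat n m"
  shows "A = B"
proof (rule eq_matI)
  fix i j assume ij: "i < dim_row B" "j < dim_col B"
  have ij': "i < n" "j < m" using ij assms by auto
  have "(\<Sum>i<n. \<Sum>j<m. (norm ((A - B) $$ (i, j)))\<^sup>2) = 0"
    using assms by (auto simp: frob_norm_def)
  then have "(\<Sum>j<m. (norm ((A - B) $$ (i, j)))\<^sup>2) = 0"
    using ij' by (simp add: sum_nonneg_eq_0_iff sum_nonneg)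
  then have "(norm ((A - B) $$ (i, j)))\<^sup>2 = 0"
    using ij' by (simp add: sum_nonneg_eq_0_iff)
  then show "A $$ (i, j) = B $$ (i, j)" using ij assms by auto
qed (use assms in auto)

lemma psd_splitting_unique:
  fixes A :: "'a :: rc_field mat"
  assumes "psd_splitting n A P N" "psd_splitting n A X M"
  shows "X = P"
proof (rule frob_norm_eq_0)
  show "P \<in> carrier_mat n n" "X \<in> carrier_mat n n" using assms by (auto dest: psd_splittingD)
  have "(frob_norm (X - P))\<^sup>2 \<le> (frob_norm (A - A))\<^sup>2" by (rule psd_splitting_nonexpansive[OF assms])
  moreover have "frob_norm (A - A) = 0" by (simp add: frob_norm_def)
  ultimately show "frob_norm (X - P) = 0" by simp
qed

section \<open>The projection in terms of eigendecompositions\<close>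

text \<open>The columns of \<open>Vp\<close> and \<open>Vm\<close> are mutually orthogonal, so the
  two parts multiply to zero; the signs of the eigenvalues make both positive semidefinite.\<close>

lemma psd_splitting_of_signed_eigendecomp:
  fixes A :: "'a :: rc_field mat"
  assumes "signed_eigendecomp A Vp Lp Vm Lm" "A \<in> carrier_mat n n"
  shows "psd_splitting n A (Vp * Lp * mat_adjoint Vp) (Vm * (- Lm) * mat_adjoint Vm)"
proof -
  obtain p q where pq: "p + q = n"
    and V: "Vp \<in> carrier_mat n p" "Vm \<in> carrier_mat n q"
    and on: "orthonormal_cols n n (mat_of_cols n (cols Vp @ cols Vm))"
    and Lp: "Lp \<in> carrier_mat p p" "diagonal_mat Lp" "\<forall>i<p. 0 < Lp $$ (i, i)"
    and Lm: "Lm \<in> carrier_mat q q" "diagonal_mat Lm" "\<forall>i<q. Lm $$ (i, i) \<le> 0"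
    and A: "A = Vp * Lp * mat_adjoint Vp + Vm * Lm * mat_adjoint Vm"
    using assms unfolding signed_eigendecomp_def by fastforce
  let ?Q = "mat_of_cols n (cols Vp @ cols Vm)"
  have "mat_adjoint Vp * Vm = 0\<^sub>m p q"
  proof (rule eq_matI)
    fix i j assume "i < dim_row (0\<^sub>m p q :: 'a mat)" "j < dim_col (0\<^sub>m p q :: 'a mat)"
    then have ij: "i < p" "j < q" by auto
    \<comment> \<open>This is an off-diagonal block of the Gram matrix of \<open>?Q\<close>: column
      \<open>j\<close> of \<open>Vm\<close> sits at position \<open>p + j\<close>, which differs
      from \<open>i < p\<close>.\<close>
    have "(mat_adjoint Vp * Vm) $$ (i, j) = (mat_adjoint ?Q * ?Q) $$ (i, p + j)"
      using ij V pq
      by (auto simp: scalar_prod_def mat_of_cols_index nth_append intro!: sum.cong)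
    also have "\<dots> = (1\<^sub>m n :: 'a mat) $$ (i, p + j)" using on by (simp add: orthonormal_cols_def)
    finally show "(mat_adjoint Vp * Vm) $$ (i, j) = 0\<^sub>m p q $$ (i, j)" using ij pq by simp
  qed (use V in auto)
  moreover have "(Vp * Lp * mat_adjoint Vp) * (Vm * (- Lm) * mat_adjoint Vm)
      = Vp * Lp * ((mat_adjoint Vp * Vm) * (- Lm) * mat_adjoint Vm)"
  proof -
    have "(Vp * Lp * mat_adjoint Vp) * (Vm * (- Lm) * mat_adjoint Vm)
        = Vp * Lp * (mat_adjoint Vp * (Vm * (- Lm) * mat_adjoint Vm))"
      using V Lp Lm by (intro assoc_mult_mat[of _ n p _ n _ n]) auto
    also have "mat_adjoint Vp * (Vm * (- Lm) * mat_adjoint Vm)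
        = mat_adjoint Vp * (Vm * (- Lm)) * mat_adjoint Vm"
      using V Lm by (intro assoc_mult_mat[of _ p n _ q _ n, symmetric]) auto
    also have "mat_adjoint Vp * (Vm * (- Lm)) = mat_adjoint Vp * Vm * (- Lm)"
      using V Lm by (intro assoc_mult_mat[of _ p n _ q _ q, symmetric]) auto
    finally show ?thesis .
  qed
  moreover have "- (0\<^sub>m n n :: 'a mat) = 0\<^sub>m n n" by (intro eq_matI) auto
  ultimately have "(Vp * Lp * mat_adjoint Vp) * (Vm * (- Lm) * mat_adjoint Vm) = 0\<^sub>m n n"
    using V Lp Lm
    by (simp add: left_mult_zero_mat[of "- Lm" q q] left_mult_zero_mat[of "mat_adjoint Vm" q n]
        right_mult_zero_mat[of "Vp * Lp" n p])
  moreover have "psd_mat n (Vp * Lp * mat_adjoint Vp)"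
    using V Lp by (intro psd_mat_congruence[of p] psd_mat_diagonal) (auto intro: less_imp_le)
  moreover have "psd_mat n (Vm * (- Lm) * mat_adjoint Vm)"
  proof (intro psd_mat_congruence[of q] psd_mat_diagonal)
    fix i assume "i < q"
    then have "Lm $$ (i, i) + - Lm $$ (i, i) \<le> 0 + - Lm $$ (i, i)"
      using Lm by (intro add_right_mono) auto
    then show "0 \<le> (- Lm) $$ (i, i)" using Lm \<open>i < q\<close> by simp
  qed (use V Lm in \<open>auto simp: diagonal_mat_def\<close>)
  moreover have "A = Vp * Lp * mat_adjoint Vp - Vm * (- Lm) * mat_adjoint Vm"
  proof -
    have "Vm * (- Lm) * mat_adjoint Vm = - (Vm * Lm * mat_adjoint Vm)"
      using V Lm by simp
    then show ?thesis unfolding A using V Lp Lm by (intro eq_matI) auto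
  qed
  ultimately show ?thesis by (simp add: psd_splitting_def)
qed

text \<open>Writes a decomposition restricted to the columns listed in \<open>ks\<close> as a sum of
  rank-one terms, so that splitting the index list splits the matrix.\<close>

lemma mat_of_cols_diag_congruence:
  fixes U :: "'a :: rc_field mat"
  assumes "U \<in> carrier_mat n n" "set ks \<subseteq> {..<n}"
  defines "V \<equiv> mat_of_cols n (map (col U) ks)"
  shows "V * mat_diag (length ks) (\<lambda>i. f (ks ! i)) * mat_adjoint V
    = mat n n (\<lambda>(a, b). \<Sum>k\<leftarrow>ks. U $$ (a, k) * f k * conjugate (U $$ (b, k)))"
proof (rule eq_matI)
  have ks: "ks ! i < n" if "i < length ks" for i using assms(2) nth_mem[OF that] by auto
  have V: "V \<in> carrier_mat n (length ks)"
    using mat_of_cols_carrier(1)[of n "map (col U) ks"] by (simp add: V_def)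
  have Vi: "V $$ (a, i) = U $$ (a, ks ! i)" if "a < n" "i < length ks" for a i
    using that assms(1) ks by (simp add: V_def mat_of_cols_index)
  fix a b
  assume "a < dim_row (mat n n (\<lambda>(a, b). \<Sum>k\<leftarrow>ks. U $$ (a, k) * f k * conjugate (U $$ (b, k))))"
    "b < dim_col (mat n n (\<lambda>(a, b). \<Sum>k\<leftarrow>ks. U $$ (a, k) * f k * conjugate (U $$ (b, k))))"
  then have ab: "a < n" "b < n" by auto
  then show "(V * mat_diag (length ks) (\<lambda>i. f (ks ! i)) * mat_adjoint V) $$ (a, b)
      = mat n n (\<lambda>(a, b). \<Sum>k\<leftarrow>ks. U $$ (a, k) * f k * conjugate (U $$ (b, k))) $$ (a, b)"
    unfolding mat_diag_mult_right[OF V] using V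
    by (auto simp: scalar_prod_def Vi sum_list_sum_nth intro!: sum.cong)
qed (auto simp: V_def)

lemma sum_list_filter_split:
  fixes g :: "'b \<Rightarrow> 'a :: comm_monoid_add"
  shows "sum_list (map g xs) = sum_list (map g (filter Q xs)) + sum_list (map g (filter (\<lambda>x. \<not> Q x) xs))"
  by (induction xs) (auto simp: ac_simps)

text \<open>Diagonalise \<open>A\<close> and reorder the eigenvectors so that those with positive
  eigenvalue come first.\<close>

lemma signed_eigendecomp_exists:
  fixes A :: "'a :: rc_field mat"
  assumes "hermitian_mat n A"
  obtains Vp Lp Vm Lm where "signed_eigendecomp A Vp Lp Vm Lm"
proof -
  obtain U d where U: "unitary_mat n U" and A: "A = U * mat_diag n (\<lambda>i. of_real (d i)) * mat_adjoint U"
    using hermitian_mat_diagonalize[OF assms] by blast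
  have Uc: "U \<in> carrier_mat n n" using U by (simp add: unitary_mat_def)
  define ps where "ps = filter (\<lambda>i. 0 < d i) [0..<n]"
  \<comment> \<open>Zero eigenvalues are placed in the non-positive block.\<close>
  define ms where "ms = filter (\<lambda>i. \<not> 0 < d i) [0..<n]"
  have sets: "set ps \<subseteq> {..<n}" "set ms \<subseteq> {..<n}" by (auto simp: ps_def ms_def)
  have len: "length ps + length ms = n"
    using sum_length_filter_compl[of _ "[0..<n]"] by (simp add: ps_def ms_def)
  have dist: "distinct (ps @ ms)" by (auto simp: ps_def ms_def)
  define V where "V ks = mat_of_cols n (map (col U) ks)" for ks
  define L where "L ks = mat_diag (length ks) (\<lambda>i. of_real (d (ks ! i)) :: 'a)" for ks
  have Vc: "V ks \<in> carrier_mat n (length ks)" for ks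
    using mat_of_cols_carrier(1)[of n "map (col U) ks"] by (simp add: V_def)
  have cols: "cols (V ks) = map (col U) ks" for ks
    unfolding V_def using Uc by (intro cols_mat_of_cols) auto
  have VLV: "V ks * L ks * mat_adjoint (V ks)
      = mat n n (\<lambda>(a, b). \<Sum>k\<leftarrow>ks. U $$ (a, k) * of_real (d k) * conjugate (U $$ (b, k)))"
    if "set ks \<subseteq> {..<n}" for ks
    unfolding V_def L_def using Uc that by (rule mat_of_cols_diag_congruence)
  have "U = V [0..<n]" using Uc by (intro eq_matI) (auto simp: V_def mat_of_cols_index)
  moreover have "mat_diag n (\<lambda>i. of_real (d i)) = L [0..<n]" by (intro eq_matI) (auto simp: L_def mat_diag_def)
  ultimately have "A = V [0..<n] * L [0..<n] * mat_adjoint (V [0..<n])" using A by simp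
  also have "\<dots> = V ps * L ps * mat_adjoint (V ps) + V ms * L ms * mat_adjoint (V ms)"
    unfolding VLV[OF sets(1)] VLV[OF sets(2)]
    by (subst VLV, force, intro eq_matI) (auto simp: ps_def ms_def intro!: sum_list_filter_split)
  finally have AV: "A = V ps * L ps * mat_adjoint (V ps) + V ms * L ms * mat_adjoint (V ms)" .
  have "orthonormal_cols n n (V (ps @ ms))"
    unfolding orthonormal_cols_def
  proof (intro conjI eq_matI)
    show "V (ps @ ms) \<in> carrier_mat n n" using Vc[of "ps @ ms"] len by simp
    let ?ks = "ps @ ms"
    fix i j assume "i < dim_row (1\<^sub>m n :: 'a mat)" "j < dim_col (1\<^sub>m n :: 'a mat)"
    then have ij: "i < n" "j < n" by auto
    have ks: "?ks ! i < n" "?ks ! j < n" using nth_mem[of i ?ks] nth_mem[of j ?ks] ij len sets by auto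
    \<comment> \<open>Reordering the columns only permutes the indices of the Gram matrix of
      \<open>U\<close>; as the list is distinct, equal entries mean equal positions.\<close>
    have "(mat_adjoint (V ?ks) * V ?ks) $$ (i, j) = (mat_adjoint U * U) $$ (?ks ! i, ?ks ! j)"
      using ij ks len Uc
      by (auto simp: V_def scalar_prod_def mat_of_cols_index simp del: map_append intro!: sum.cong)
    also have "\<dots> = (1\<^sub>m n :: 'a mat) $$ (?ks ! i, ?ks ! j)" using U by (simp add: unitary_mat_def)
    also have "\<dots> = (1\<^sub>m n :: 'a mat) $$ (i, j)" using ij ks len nth_eq_iff_index_eq[OF dist] by auto
    finally show "(mat_adjoint (V ?ks) * V ?ks) $$ (i, j) = (1\<^sub>m n :: 'a mat) $$ (i, j)" .
  qed (use Vc[of "ps @ ms"] len in auto)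
  moreover have "V (ps @ ms) = mat_of_cols n (cols (V ps) @ cols (V ms))"
    by (simp add: cols) (simp add: V_def)
  moreover have "A \<in> carrier_mat n n" using hermitian_matD assms by auto
  moreover have "0 < L ps $$ (i, i)" if "i < length ps" for i
  proof -
    have "0 < d (ps ! i)" using nth_mem[OF that] by (auto simp: ps_def)
    then show ?thesis using that by (simp add: L_def mat_diag_def order.strict_iff_order)
  qed
  moreover have "L ms $$ (i, i) \<le> 0" if "i < length ms" for i
  proof -
    let ?r = "d (ms ! i)"
    have "?r \<le> 0" using nth_mem[OF that] by (auto simp: ms_def)
    then have "(0 :: 'a) + of_real ?r \<le> of_real (- ?r) + of_real ?r"
      by (intro add_right_mono) (simp del: of_real_minus)
    then show ?thesis using that by (simp add: L_def mat_diag_def)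
  qed
  moreover have "L ks \<in> carrier_mat (length ks) (length ks)" "diagonal_mat (L ks)" for ks
    by (auto simp: L_def mat_diag_def diagonal_mat_def)
  ultimately have "signed_eigendecomp A (V ps) (L ps) (V ms) (L ms)"
    unfolding signed_eigendecomp_def using AV Vc len
    by - (rule exI[of _ n], rule exI[of _ "length ps"], rule exI[of _ "length ms"], simp)
  then show thesis by (rule that)
qed

text \<open>Every signed eigendecomposition of \<open>A\<close> yields a splitting and the splitting
  is unique, so the description in \<open>Pi_plus\<close> denotes the common positive part.\<close>

lemma psd_splitting_Pi_plus:
  fixes A :: "'a :: rc_field mat"
  assumes "hermitian_mat n A"
  obtains N where "psd_splitting n A (Pi_plus A) N"
proof -
  have A: "A \<in> carrier_mat n n" using hermitian_matD assms by auto
  note split = psd_splitting_of_signed_eigendecomp[OF _ A]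
  obtain Vp Lp Vm Lm where dec: "signed_eigendecomp A Vp Lp Vm Lm"
    using signed_eigendecomp_exists[OF assms] .
  have "Pi_plus A = Vp * Lp * mat_adjoint Vp"
    unfolding Pi_plus_def using dec psd_splitting_unique[OF split split] by (intro the_equality) blast+
  then show thesis using that split[OF dec] by simp
qed

section \<open>The residual bound\<close>

lemma eq_mat_vecI:
  fixes A B :: "'a :: semiring_1 mat"
  assumes "A \<in> carrier_mat n m" "B \<in> carrier_mat n m"
    and "\<And>x. x \<in> carrier_vec m \<Longrightarrow> A *\<^sub>v x = B *\<^sub>v x"
  shows "A = B"
proof (rule eq_matI)
  fix i j assume ij: "i < dim_row B" "j < dim_col B"
  have "M $$ (i, j) = (M *\<^sub>v unit_vec m j) $ i" if "M \<in> carrier_mat n m" for M :: "'a mat"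
    using ij assms(2) that by simp
  then show "A $$ (i, j) = B $$ (i, j)" using assms by simp
qed (use assms in auto)

text \<open>The columns of \<open>W\<close> lie in the kernel of \<open>mat_adjoint V\<close>, which
  gives orthogonality. Conversely, the remainder of \<open>x\<close> after projection onto the range
  of \<open>V\<close> lies in that kernel, hence in the range of \<open>W\<close>.\<close>

lemma orthonormal_cols_complement:
  fixes V W :: "'a :: conjugatable_field mat"
  assumes V: "V \<in> carrier_mat n k" "mat_adjoint V * V = 1\<^sub>m k"
    and W: "W \<in> carrier_mat n l" "mat_adjoint W * W = 1\<^sub>m l"
    and space: "vec_space.col_space n W = mat_kernel (mat_adjoint V)"
  shows "mat_adjoint V * W = 0\<^sub>m k l" "V * mat_adjoint V + W * mat_adjoint W = 1\<^sub>m n"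
proof -
  interpret vec_space "TYPE('a)" n .
  have image: "mat_kernel (mat_adjoint V) = {y \<in> carrier_vec n. \<exists>x\<in>carrier_vec l. W *\<^sub>v x = y}"
    using space col_space_eq[of W l] W(1) by auto
  have ker: "y \<in> mat_kernel (mat_adjoint V) \<longleftrightarrow> y \<in> carrier_vec n \<and> mat_adjoint V *\<^sub>v y = 0\<^sub>v k" for y
    using V(1) by (subst mat_kernel[of _ k n]) auto
  have VW_vec: "(mat_adjoint V * W) *\<^sub>v x = 0\<^sub>v k" if "x \<in> carrier_vec l" for x
  proof -
    have "W *\<^sub>v x \<in> mat_kernel (mat_adjoint V)" unfolding image using that W(1) by auto
    then show ?thesis unfolding ker using that V W by (simp add: assoc_mult_mat_vec[of _ k n _ l])
  qed
  show VW: "mat_adjoint V * W = 0\<^sub>m k l"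
    using VW_vec V(1) W(1) by (intro eq_mat_vecI[of _ k l]) auto
  show "V * mat_adjoint V + W * mat_adjoint W = 1\<^sub>m n"
  proof (rule eq_mat_vecI)
    fix x :: "'a vec" assume x: "x \<in> carrier_vec n"
    \<comment> \<open>\<open>Vx\<close> and \<open>Wx\<close> are the projections of
      \<open>x\<close> onto the ranges of \<open>V\<close> and \<open>W\<close>.\<close>
    define Vx where "Vx = V *\<^sub>v (mat_adjoint V *\<^sub>v x)"
    define Wx where "Wx = W *\<^sub>v (mat_adjoint W *\<^sub>v x)"
    have c: "mat_adjoint V *\<^sub>v x \<in> carrier_vec k" "mat_adjoint W *\<^sub>v x \<in> carrier_vec l"
      "Vx \<in> carrier_vec n" "Wx \<in> carrier_vec n"
      using V W x by (auto simp: Vx_def Wx_def mult_mat_vec_carrier[of _ k n] mult_mat_vec_carrier[of _ l n])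
    have "mat_adjoint V *\<^sub>v Vx = (mat_adjoint V * V) *\<^sub>v (mat_adjoint V *\<^sub>v x)"
      unfolding Vx_def using V c by (intro assoc_mult_mat_vec[of _ k n _ k, symmetric]) auto
    then have VVx: "mat_adjoint V *\<^sub>v Vx = mat_adjoint V *\<^sub>v x" using V c by simp
    have "mat_adjoint W *\<^sub>v Vx = (mat_adjoint W * V) *\<^sub>v (mat_adjoint V *\<^sub>v x)"
      unfolding Vx_def using V W c by (intro assoc_mult_mat_vec[of _ l n _ k, symmetric]) auto
    also have "mat_adjoint W * V = mat_adjoint (mat_adjoint V * W)"
      using V W mat_adjoint_mult[of "mat_adjoint V" k n W l] by simp
    also have "mat_adjoint (mat_adjoint V * W) *\<^sub>v (mat_adjoint V *\<^sub>v x) = 0\<^sub>v l"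
      unfolding VW using c(1) by (intro eq_vecI) auto
    finally have WVx: "mat_adjoint W *\<^sub>v Vx = 0\<^sub>v l" .
    have "mat_adjoint V *\<^sub>v (x - Vx) = 0\<^sub>v k"
      using V x c VVx by (simp add: mult_minus_distrib_mat_vec[of _ k n])
    then have "x - Vx \<in> mat_kernel (mat_adjoint V)" unfolding ker using x c by simp
    then obtain z where z: "z \<in> carrier_vec l" "W *\<^sub>v z = x - Vx" unfolding image by auto
    \<comment> \<open>Applying \<open>mat_adjoint W\<close> recovers the coefficients
      \<open>z\<close> of the remainder; since it annihilates \<open>Vx\<close>, they are those of
      \<open>x\<close> itself.\<close>
    have "z = (mat_adjoint W * W) *\<^sub>v z" using W z by simp
    also have "\<dots> = mat_adjoint W *\<^sub>v (x - Vx)"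
      unfolding z(2)[symmetric] using W(1) z(1) by (intro assoc_mult_mat_vec[of _ l n _ l]) auto
    also have "\<dots> = mat_adjoint W *\<^sub>v x"
      using W x c WVx by (simp add: mult_minus_distrib_mat_vec[of _ l n])
    finally have "Wx = x - Vx" using z by (simp add: Wx_def)
    moreover have "(V * mat_adjoint V + W * mat_adjoint W) *\<^sub>v x = Vx + Wx"
      using V W x
      by (simp add: add_mult_distrib_mat_vec[of _ n n] mult_carrier_mat[of _ n k] mult_carrier_mat[of _ n l]
          assoc_mult_mat_vec[of V n k _ n] assoc_mult_mat_vec[of W n l _ n] Vx_def Wx_def)
    ultimately show "(V * mat_adjoint V + W * mat_adjoint W) *\<^sub>v x = 1\<^sub>m n *\<^sub>v x"
      using x c by auto
  qed (use V W in auto)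
qed

lemma frob_norm_mat_adjoint:
  fixes A :: "'a :: rc_field mat"
  shows "frob_norm (mat_adjoint A) = frob_norm A"
proof -
  have norm_conjugate: "norm (conjugate x) = norm x" for x :: 'a
    by (metis complex_mod_cnj norm_to_complex to_complex_conjugate)
  show ?thesis unfolding frob_norm_def by (simp add: norm_conjugate) (subst sum.swap, rule refl)
qed

text \<open>Insert the resolution of the identity between \<open>C\<close> and its adjoint in
  \<open>C * mat_adjoint C\<close> and take traces.\<close>

lemma frob_norm_split:
  fixes C V W :: "'a :: rc_field mat"
  assumes C: "C \<in> carrier_mat m n" and V: "V \<in> carrier_mat n k" and W: "W \<in> carrier_mat n l"
    and sum: "V * mat_adjoint V + W * mat_adjoint W = 1\<^sub>m n"
  shows "(frob_norm C)\<^sup>2 = (frob_norm (C * V))\<^sup>2 + (frob_norm (C * W))\<^sup>2"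
proof -
  have prod: "(C * U) * mat_adjoint (C * U) = C * (U * mat_adjoint U) * mat_adjoint C"
    if U: "U \<in> carrier_mat n j" for U j
  proof -
    have "(C * U) * mat_adjoint (C * U) = (C * U) * (mat_adjoint U * mat_adjoint C)"
      using C U by (simp add: mat_adjoint_mult)
    also have "\<dots> = (C * U) * mat_adjoint U * mat_adjoint C"
      using C U by (intro assoc_mult_mat[of _ m j _ n _ m, symmetric]) auto
    also have "(C * U) * mat_adjoint U = C * (U * mat_adjoint U)"
      using C U by (intro assoc_mult_mat[of _ m n _ j _ n]) auto
    finally show ?thesis .
  qed
  have VV: "V * mat_adjoint V \<in> carrier_mat n n" and WW: "W * mat_adjoint W \<in> carrier_mat n n"
    using V W by auto
  have "C * mat_adjoint C = C * (V * mat_adjoint V + W * mat_adjoint W) * mat_adjoint C"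
    unfolding sum using C by simp
  also have "C * (V * mat_adjoint V + W * mat_adjoint W) = C * (V * mat_adjoint V) + C * (W * mat_adjoint W)"
    using C VV WW by (intro mult_add_distrib_mat) auto
  also have "\<dots> * mat_adjoint C
      = C * (V * mat_adjoint V) * mat_adjoint C + C * (W * mat_adjoint W) * mat_adjoint C"
    using C VV WW by (intro add_mult_distrib_mat[of _ m n]) auto
  finally have "C * mat_adjoint C = (C * V) * mat_adjoint (C * V) + (C * W) * mat_adjoint (C * W)"
    unfolding prod[OF V] prod[OF W] .
  moreover have "(C * V) * mat_adjoint (C * V) \<in> carrier_mat m m"
    "(C * W) * mat_adjoint (C * W) \<in> carrier_mat m m"
    using C V W by (meson mat_adjoint_carrier mult_carrier_mat)+
  ultimately have "(of_real ((frob_norm C)\<^sup>2) :: 'a)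
      = of_real ((frob_norm (C * V))\<^sup>2 + (frob_norm (C * W))\<^sup>2)"
    unfolding of_real_add frob_norm_square by (simp add: mat_trace_add[of _ m])
  then show ?thesis by (simp only: of_real_eq_iff)
qed

text \<open>Stated for the whole scalar class, so that the real and the complex case are both
  instances.\<close>

lemma Pi_plus_frob_norm_bound:
  fixes A V \<Lambda> W :: "'a :: rc_field mat"
  assumes A: "hermitian_mat n A" and V: "orthonormal_cols n k V" and L: "psd_mat k \<Lambda>"
    and W: "orthonormal_cols n l W"
    and space: "vec_space.col_space n W = mat_kernel (mat_adjoint V)"
  shows "(frob_norm (V * \<Lambda> * mat_adjoint V - Pi_plus A))\<^sup>2
    \<le> (frob_norm (A * V - V * \<Lambda>))\<^sup>2 + (frob_norm (mat_adjoint W * A * V))\<^sup>2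
      + (frob_norm (Pi_plus (mat_adjoint W * A * W)))\<^sup>2"
proof -
  have Ac: "A \<in> carrier_mat n n" "mat_adjoint A = A" using hermitian_matD A by auto
  have Lc: "\<Lambda> \<in> carrier_mat k k" using L by (auto simp: psd_mat_def hermitian_mat_def)
  have Vc: "V \<in> carrier_mat n k" "mat_adjoint V * V = 1\<^sub>m k" using V by (auto simp: orthonormal_cols_def)
  have Wc: "W \<in> carrier_mat n l" "mat_adjoint W * W = 1\<^sub>m l" using W by (auto simp: orthonormal_cols_def)
  note VW = orthonormal_cols_complement[OF Vc Wc space]
  have WV: "mat_adjoint W * V = 0\<^sub>m l k"
    using arg_cong[OF VW(1), of mat_adjoint] mat_adjoint_mult[of "mat_adjoint V" k n W l] Vc Wc by simp
  define D where "D = mat_adjoint W * A * W"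
  obtain N where N: "psd_splitting n A (Pi_plus A) N" using psd_splitting_Pi_plus[OF A] .
  obtain M where M: "psd_splitting l D (Pi_plus D) M"
    using psd_splitting_Pi_plus hermitian_mat_congruence[OF A Wc(1)] unfolding D_def by blast
  note Mpsd = psd_splittingD(2)[OF M] and D_eq = psd_splittingD(4)[OF M]
    and Mc = psd_splittingD(5,6)[OF M]
  \<comment> \<open>The comparison matrix is \<open>X - Y\<close>: it acts as
    \<open>\<Lambda>\<close> on the range of \<open>V\<close> and as \<open>- M\<close> on its
    complement.\<close>
  define X where "X = V * \<Lambda> * mat_adjoint V"
  define Y where "Y = W * M * mat_adjoint W"
  have Xc: "X \<in> carrier_mat n n" and Yc: "Y \<in> carrier_mat n n"
    unfolding X_def Y_def using Vc Wc Lc Mc by (meson mat_adjoint_carrier mult_carrier_mat)+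
  have XU: "X * U = V * \<Lambda> * (mat_adjoint V * U)" if "U \<in> carrier_mat n j" for U j
    unfolding X_def using that Vc Lc by (intro assoc_mult_mat[of _ n k _ n _ j]) auto
  have YU: "Y * U = W * M * (mat_adjoint W * U)" if "U \<in> carrier_mat n j" for U j
    unfolding Y_def using that Wc Mc by (intro assoc_mult_mat[of _ n l _ n _ j]) auto
  have XV: "X * V = V * \<Lambda>" using Vc Lc by (simp add: XU[OF Vc(1)])
  have XW: "X * W = 0\<^sub>m n l" using Vc Lc VW by (simp add: XU[OF Wc(1)])
  have YV: "Y * V = 0\<^sub>m n k" using Wc Mc WV by (simp add: YU[OF Vc(1)])
  have YW: "Y * W = W * M" using Wc Mc by (simp add: YU[OF Wc(1)])
  have "X * Y = X * W * (M * mat_adjoint W)"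
  proof -
    have "Y = W * (M * mat_adjoint W)"
      unfolding Y_def using Wc Mc by (intro assoc_mult_mat[of _ n l _ l _ n]) auto
    then show ?thesis using Xc Wc Mc by (simp add: assoc_mult_mat[of X n n W l "M * mat_adjoint W" n])
  qed
  then have "X * Y = 0\<^sub>m n n"
    unfolding XW using Wc Mc by (intro trans[OF _ left_mult_zero_mat[of "M * mat_adjoint W" l n n]]) auto
  \<comment> \<open>Since \<open>X\<close> annihilates \<open>W\<close>, the product
    \<open>X * Y\<close> vanishes, so \<open>X\<close> is the projection of
    \<open>X - Y\<close>.\<close>
  then have split: "psd_splitting n (X - Y) X Y"
    using psd_mat_congruence[OF L Vc(1)] psd_mat_congruence[OF Mpsd Wc(1)]
    by (simp add: psd_splitting_def X_def Y_def)
  define C where "C = A - (X - Y)"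
  have Cc: "C \<in> carrier_mat n n" using Ac Xc Yc by (simp add: C_def minus_carrier_mat)
  have CU: "C * U = A * U - (X * U - Y * U)" if "U \<in> carrier_mat n j" for U j
  proof -
    have "C * U = A * U - (X - Y) * U"
      unfolding C_def using that Ac Xc Yc by (intro minus_mult_distrib_mat) auto
    also have "(X - Y) * U = X * U - Y * U" using that Xc Yc by (intro minus_mult_distrib_mat) auto
    finally show ?thesis .
  qed
  have CV: "C * V = A * V - V * \<Lambda>"
    unfolding CU[OF Vc(1)] XV YV using Vc Lc by (intro arg_cong2[of _ _ _ _ "(-)"] refl eq_matI) auto
  have CW: "C * W = A * W + W * M"
    unfolding CU[OF Wc(1)] XW YW using Ac Wc Mc by (intro eq_matI) auto
  \<comment> \<open>The off-diagonal block: the contribution of \<open>M\<close> is lost by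
    orthogonality, and \<open>A\<close> being Hermitian identifies the rest with an adjoint.\<close>
  have "mat_adjoint V * (C * W) = mat_adjoint V * (A * W) + mat_adjoint V * (W * M)"
    unfolding CW using Ac Vc Wc Mc by (intro mult_add_distrib_mat) auto
  also have "mat_adjoint V * (W * M) = mat_adjoint V * W * M"
    using Vc Wc Mc by (intro assoc_mult_mat[of _ k n _ l _ l, symmetric]) auto
  also have "\<dots> = 0\<^sub>m k l" unfolding VW using Mc by simp
  also have "mat_adjoint V * (A * W) + 0\<^sub>m k l = mat_adjoint V * (A * W)"
    using Vc Ac Wc by (intro right_add_zero_mat) auto
  also have "\<dots> = mat_adjoint (mat_adjoint W * A * V)"
  proof -
    have "mat_adjoint (mat_adjoint W * A * V) = mat_adjoint V * mat_adjoint (mat_adjoint W * A)"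
      using Vc Ac Wc by (intro mat_adjoint_mult) auto
    also have "mat_adjoint (mat_adjoint W * A) = A * W"
      using Ac Wc mat_adjoint_mult[of "mat_adjoint W" l n A n] by simp
    finally show ?thesis ..
  qed
  finally have VCW: "mat_adjoint V * (C * W) = mat_adjoint (mat_adjoint W * A * V)" .
  \<comment> \<open>The lower diagonal block: adding \<open>M\<close> to the compression
    \<open>D\<close> cancels its negative part.\<close>
  have "mat_adjoint W * (C * W) = mat_adjoint W * (A * W) + mat_adjoint W * (W * M)"
    unfolding CW using Ac Wc Mc by (intro mult_add_distrib_mat) auto
  also have "mat_adjoint W * (W * M) = mat_adjoint W * W * M"
    using Wc Mc by (intro assoc_mult_mat[of _ l n _ l _ l, symmetric]) auto
  also have "\<dots> = M" unfolding Wc(2) using Mc by simp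
  also have "mat_adjoint W * (A * W) = D"
    unfolding D_def using Ac Wc by (intro assoc_mult_mat[of _ l n _ n _ l, symmetric]) auto
  also have "D + M = Pi_plus D"
    by (subst D_eq) (use Mc in \<open>intro eq_matI; auto\<close>)
  finally have WCW: "mat_adjoint W * (C * W) = Pi_plus D" .
  have CWc: "C * W \<in> carrier_mat n l" using Cc Wc by simp
  \<comment> \<open>\<open>frob_norm_split\<close> works by multiplication from the right, so the
    rows of \<open>C * W\<close> are split through its adjoint.\<close>
  have "(frob_norm (C * W))\<^sup>2 = (frob_norm (mat_adjoint (C * W)))\<^sup>2"
    by (simp add: frob_norm_mat_adjoint)
  also have "\<dots> = (frob_norm (mat_adjoint (C * W) * V))\<^sup>2 + (frob_norm (mat_adjoint (C * W) * W))\<^sup>2"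
    by (rule frob_norm_split[OF mat_adjoint_carrier[OF CWc] Vc(1) Wc(1) VW(2)])
  finally have CW2: "(frob_norm (C * W))\<^sup>2
      = (frob_norm (mat_adjoint (C * W) * V))\<^sup>2 + (frob_norm (mat_adjoint (C * W) * W))\<^sup>2" .
  have swap: "frob_norm (mat_adjoint (C * W) * U) = frob_norm (mat_adjoint U * (C * W))"
    if "U \<in> carrier_mat n j" for U j
    using mat_adjoint_mult[of "mat_adjoint U" j n "C * W" l] that CWc
    by (metis frob_norm_mat_adjoint mat_adjoint_adjoint mat_adjoint_carrier)
  have "(frob_norm (C * W))\<^sup>2 = (frob_norm (mat_adjoint W * A * V))\<^sup>2 + (frob_norm (Pi_plus D))\<^sup>2"
    unfolding CW2 swap[OF Vc(1)] swap[OF Wc(1)] VCW WCW frob_norm_mat_adjoint ..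
  then have "(frob_norm C)\<^sup>2 = (frob_norm (A * V - V * \<Lambda>))\<^sup>2
      + ((frob_norm (mat_adjoint W * A * V))\<^sup>2 + (frob_norm (Pi_plus D))\<^sup>2)"
    using frob_norm_split[OF Cc Vc(1) Wc(1) VW(2)] by (simp add: CV)
  moreover have "(frob_norm (X - Pi_plus A))\<^sup>2 \<le> (frob_norm C)\<^sup>2"
    unfolding C_def by (rule psd_splitting_nonexpansive[OF N split])
  ultimately show ?thesis by (simp add: X_def D_def)
qed

theorem theorem2p1:
  shows
   "(\<forall>(n::nat) (k::nat) (A :: real mat) V \<Lambda> W.
      hermitian_mat n A \<and> k \<le> n \<and> orthonormal_cols n k V \<and> psd_mat k \<Lambda> \<and>
      orthonormal_cols n (n - k) W \<and>
      vec_space.col_space n W = mat_kernel (mat_adjoint V) \<longrightarrow>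
      (let R = A * V - V * \<Lambda>;
           D = Pi_plus (mat_adjoint W * A * W)
       in (frob_norm (V * \<Lambda> * mat_adjoint V - Pi_plus A))\<^sup>2
            \<le> (frob_norm R)\<^sup>2 + (frob_norm (mat_adjoint W * A * V))\<^sup>2 + (frob_norm D)\<^sup>2))
    \<and>
    (\<forall>(n::nat) (k::nat) (A :: complex mat) V \<Lambda> W.
      hermitian_mat n A \<and> k \<le> n \<and> orthonormal_cols n k V \<and> psd_mat k \<Lambda> \<and>
      orthonormal_cols n (n - k) W \<and>
      vec_space.col_space n W = mat_kernel (mat_adjoint V) \<longrightarrow>
      (let R = A * V - V * \<Lambda>;
           D = Pi_plus (mat_adjoint W * A * W)
       in (frob_norm (V * \<Lambda> * mat_adjoint V - Pi_plus A))\<^sup>2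
            \<le> (frob_norm R)\<^sup>2 + (frob_norm (mat_adjoint W * A * V))\<^sup>2 + (frob_norm D)\<^sup>2))"
  unfolding Let_def
  \<comment> \<open>Both conjuncts are instances of the bound, with \<open>l\<close> taken as
    \<open>n - k\<close>.\<close>
  by (intro conjI allI impI; elim conjE; rule Pi_plus_frob_norm_bound; assumption)

end
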